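(* There exists a complex $2$-form $\mathbf{C}=\mathbf{C}_1+\mathrm{i}\,\mathbf{C}_2$ with $\mathbf{C}_1,\mathbf{C}_2\in\bigwedge^2(\mathbb{R}^4)$ such that, for every Lagrangian frame $\mathbf{Z}=\begin{pmatrix}\mathbf{X}\\ \mathbf{Y}\end{pmatrix}=[\mathbf{z}_1\,|\,\mathbf{z}_2]\in\mathbb{R}^{4\times2}$, with $\mathbf{U}=\mathbf{z}_1\wedge\mathbf{z}_2\in\bigwedge^2(\mathbb{R}^4)$, $$\det[\mathbf{X}-\mathrm{i}\mathbf{Y}]\,\mathrm{vol}=\mathbf{C}\wedge\mathbf{U}.$$
   Context: $\mathbf{J}=\begin{pmatrix}\mathbf{0}&-\mathbf{I}\\ \mathbf{I}&\mathbf{0}\end{pmatrix}$ is the standard symplectic operator on $\mathbb{R}^4$ ($2\times2$ blocks). A Lagrangian frame is a real $4\times2$ matrix $\mathbf{Z}$ of rank 2, with columns $\mathbf{z}_1,\mathbf{z}_2$ satisfying $\langle\mathbf{J}\mathbf{z}_1,\mathbf{z}_2\rangle=0$; it is partitioned into $2\times2$ real blocks $\mathbf{X}$ (top) and $\mathbf{Y}$ (bottom). $\mathrm{vol}=\mathbf{e}_1\wedge\mathbf{e}_2\wedge\mathbf{e}_3\wedge\mathbf{e}_4$, with $\mathbf{e}_1,\dots,\mathbf{e}_4$ the canonical basis of $\mathbb{R}^4$. The wedge product is extended complex-linearly. *)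

theory Defs
  imports "HOL-Analysis.Analysis"
begin

section \<open>The exterior algebra of a coordinate space\<close>

text \<open>
  An element of the exterior algebra of $K^n$ is given by its coordinates in the basis
  $e_S = e_{i_1} \wedge \dots \wedge e_{i_k}$, where $S = \{i_1 < \dots < i_k\}$ ranges over
  the subsets of the index type \<open>'n\<close>. Which linear order is used on \<open>'n\<close> affects only the
  signs of these basis elements. (In the index type \<open>4\<close> the numeral \<open>4\<close> denotes \<open>0\<close> and
  is therefore the least index, so $e_1 \wedge e_2 \wedge e_3 \wedge e_4$ is minus the basis
  element attached to \<open>UNIV\<close>.)
\<close>

type_synonym ('a, 'n) exterior = "'a ^ ('n set)"

text \<open>
  For disjoint \<open>A\<close> and \<open>B\<close>, sorting the concatenation of their increasing enumerations gives
  $e_A \wedge e_B = \pm e_{A \cup B}$ with the following sign; otherwise $e_A \wedge e_B = 0$.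
\<close>

definition shuffle_sign :: "'n::linorder set \<Rightarrow> 'n set \<Rightarrow> 'a::comm_ring_1" where
  "shuffle_sign A B = (- 1) ^ card {(a, b). a \<in> A \<and> b \<in> B \<and> b < a}"

definition wedge ::
    "('a::comm_ring_1, 'n::{finite,linorder}) exterior \<Rightarrow> ('a, 'n) exterior \<Rightarrow> ('a, 'n) exterior"
    (infixl "\<and>\<^sub>\<Lambda>" 75)
  where "x \<and>\<^sub>\<Lambda> y = (\<chi> S. \<Sum>A\<in>Pow S. shuffle_sign A (S - A) * x $ A * y $ (S - A))"

definition ext_power :: "nat \<Rightarrow> ('a::zero, 'n::finite) exterior set" where
  "ext_power k = {x. \<forall>S. x $ S \<noteq> 0 \<longrightarrow> card S = k}"

definition ext_vec :: "'a::zero ^ 'n \<Rightarrow> ('a, 'n::finite) exterior" where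
  "ext_vec v = (\<chi> S. if card S = 1 then v $ the_elem S else 0)"

definition ext_one :: "('a::zero_neq_one, 'n::finite) exterior" where
  "ext_one = (\<chi> S. if S = {} then 1 else 0)"

text \<open>
  The complexification $\Lambda(R^n) \otimes C$ is identified with the exterior algebra over
  the complex numbers: same basis, complex coordinates. The lemma \<open>ext_complex_wedge\<close> below,
  together with bilinearity, shows that the complex wedge product is the complex-bilinear
  extension of the real one.
\<close>

definition ext_complex :: "(real, 'n::finite) exterior \<Rightarrow> (complex, 'n) exterior" where
  "ext_complex x = (\<chi> S. complex_of_real (x $ S))"

text \<open>The following facts characterise the wedge product: it is a bilinear, associative and
  unital product, graded, and alternating on vectors.\<close>

lemma wedge_add_left: "(x + y) \<and>\<^sub>\<Lambda> z = x \<and>\<^sub>\<Lambda> z + y \<and>\<^sub>\<Lambda> z"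
  by (simp add: wedge_def vec_eq_iff algebra_simps sum.distrib)

lemma wedge_add_right: "x \<and>\<^sub>\<Lambda> (y + z) = x \<and>\<^sub>\<Lambda> y + x \<and>\<^sub>\<Lambda> z"
  by (simp add: wedge_def vec_eq_iff algebra_simps sum.distrib)

lemma wedge_scale_left: "(c *s x) \<and>\<^sub>\<Lambda> y = c *s (x \<and>\<^sub>\<Lambda> y)"
  by (simp add: wedge_def vec_eq_iff sum_distrib_left mult_ac)

lemma wedge_scale_right: "x \<and>\<^sub>\<Lambda> (c *s y) = c *s (x \<and>\<^sub>\<Lambda> y)"
  by (simp add: wedge_def vec_eq_iff sum_distrib_left mult_ac)

lemma shuffle_sign_empty [simp]: "shuffle_sign {} B = 1" "shuffle_sign A {} = 1"
  by (simp_all add: shuffle_sign_def)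

lemma shuffle_sign_Un_left:
  fixes A B C :: "'n::{finite,linorder} set"
  assumes "A \<inter> B = {}"
  shows "shuffle_sign (A \<union> B) C = shuffle_sign A C * shuffle_sign B C"
proof -
  have "{(a, b). a \<in> A \<union> B \<and> b \<in> C \<and> b < a} =
        {(a, b). a \<in> A \<and> b \<in> C \<and> b < a} \<union> {(a, b). a \<in> B \<and> b \<in> C \<and> b < a}" by auto
  moreover have "{(a, b). a \<in> A \<and> b \<in> C \<and> b < a} \<inter> {(a, b). a \<in> B \<and> b \<in> C \<and> b < a} = {}"
    using assms by auto
  ultimately show ?thesis
    by (simp add: shuffle_sign_def card_Un_disjoint power_add)
qed

lemma shuffle_sign_Un_right:
  fixes A B C :: "'n::{finite,linorder} set"
  assumes "B \<inter> C = {}"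
  shows "shuffle_sign A (B \<union> C) = shuffle_sign A B * shuffle_sign A C"
proof -
  have "{(a, b). a \<in> A \<and> b \<in> B \<union> C \<and> b < a} =
        {(a, b). a \<in> A \<and> b \<in> B \<and> b < a} \<union> {(a, b). a \<in> A \<and> b \<in> C \<and> b < a}" by auto
  moreover have "{(a, b). a \<in> A \<and> b \<in> B \<and> b < a} \<inter> {(a, b). a \<in> A \<and> b \<in> C \<and> b < a} = {}"
    using assms by auto
  ultimately show ?thesis
    by (simp add: shuffle_sign_def card_Un_disjoint power_add)
qed

lemma wedge_assoc: "(x \<and>\<^sub>\<Lambda> y) \<and>\<^sub>\<Lambda> z = x \<and>\<^sub>\<Lambda> (y \<and>\<^sub>\<Lambda> z)"
proof (simp add: vec_eq_iff, rule allI)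
  fix S
  let ?f = "\<lambda>A B C. shuffle_sign A B * shuffle_sign A C * shuffle_sign B C * x $ A * y $ B * z $ C"
  have "((x \<and>\<^sub>\<Lambda> y) \<and>\<^sub>\<Lambda> z) $ S = (\<Sum>T\<in>Pow S. \<Sum>A\<in>Pow T. ?f A (T - A) (S - T))"
    unfolding wedge_def vec_lambda_beta sum_distrib_left sum_distrib_right
  proof (intro sum.cong refl)
    fix T A assume "T \<in> Pow S" "A \<in> Pow T"
    then have "shuffle_sign T (S - T)
        = (shuffle_sign A (S - T) * shuffle_sign (T - A) (S - T) :: 'a)"
      using shuffle_sign_Un_left[of A "T - A" "S - T"] by (simp add: Un_absorb1)
    then show "shuffle_sign T (S - T) * (shuffle_sign A (T - A) * x $ A * y $ (T - A)) * z $ (S - T)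
        = ?f A (T - A) (S - T)"
      by (simp add: mult_ac)
  qed
  also have "\<dots> = (\<Sum>(T, A)\<in>(SIGMA T:Pow S. Pow T). ?f A (T - A) (S - T))"
    by (simp add: sum.Sigma)
  also have "\<dots> = (\<Sum>(A, B)\<in>(SIGMA A:Pow S. Pow (S - A)). ?f A B (S - A - B))"
    by (rule sum.reindex_bij_witness[where i = "\<lambda>(A, B). (A \<union> B, A)"
          and j = "\<lambda>(T, A). (A, T - A)"])
      (auto intro!: arg_cong2[where f = "(*)"] arg_cong2[where f = shuffle_sign]
          arg_cong[where f = "vec_nth z"])
  also have "\<dots> = (\<Sum>A\<in>Pow S. \<Sum>B\<in>Pow (S - A). ?f A B (S - A - B))"
    by (simp add: sum.Sigma)
  also have "\<dots> = (x \<and>\<^sub>\<Lambda> (y \<and>\<^sub>\<Lambda> z)) $ S"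
    unfolding wedge_def vec_lambda_beta sum_distrib_left sum_distrib_right
  proof (intro sum.cong refl)
    fix A B assume "A \<in> Pow S" "B \<in> Pow (S - A)"
    then have "shuffle_sign A (S - A)
        = (shuffle_sign A B * shuffle_sign A (S - A - B) :: 'a)"
      using shuffle_sign_Un_right[of B "S - A - B" A] by (simp add: Un_absorb1)
    then show "?f A B (S - A - B) = shuffle_sign A (S - A) * x $ A *
        (shuffle_sign B (S - A - B) * y $ B * z $ (S - A - B))"
      by (simp add: mult_ac)
  qed
  finally show "((x \<and>\<^sub>\<Lambda> y) \<and>\<^sub>\<Lambda> z) $ S = (x \<and>\<^sub>\<Lambda> (y \<and>\<^sub>\<Lambda> z)) $ S" .
qed

lemma wedge_one_left: "ext_one \<and>\<^sub>\<Lambda> x = x"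
proof -
  have "(\<Sum>A\<in>Pow S. shuffle_sign A (S - A) * (if A = {} then 1 else 0) * x $ (S - A)) = x $ S" for S
    by (subst sum.remove[of _ "{}"]) (auto intro!: sum.neutral)
  then show ?thesis by (simp add: wedge_def ext_one_def vec_eq_iff)
qed

lemma wedge_one_right: "x \<and>\<^sub>\<Lambda> ext_one = x"
proof -
  have "(\<Sum>A\<in>Pow S. shuffle_sign A (S - A) * x $ A * (if S - A = {} then 1 else 0)) = x $ S" for S
    by (subst sum.remove[of _ S]) (auto intro!: sum.neutral split: if_splits)
  then show ?thesis by (simp add: wedge_def ext_one_def vec_eq_iff)
qed

lemma wedge_ext_power:
  assumes "x \<in> ext_power j" "y \<in> ext_power k"
  shows "x \<and>\<^sub>\<Lambda> y \<in> ext_power (j + k)"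
proof -
  have "card S = j + k" if "(x \<and>\<^sub>\<Lambda> y) $ S \<noteq> 0" for S
  proof -
    from that have "(\<Sum>A\<in>Pow S. shuffle_sign A (S - A) * x $ A * y $ (S - A)) \<noteq> 0"
      by (simp add: wedge_def)
    then obtain A where "A \<in> Pow S" "shuffle_sign A (S - A) * x $ A * y $ (S - A) \<noteq> 0"
      by (rule sum.not_neutral_contains_not_neutral)
    then have A: "A \<subseteq> S" "x $ A \<noteq> 0" "y $ (S - A) \<noteq> 0" by auto
    then have "card A = j" "card (S - A) = k" using assms by (auto simp: ext_power_def)
    moreover have "card S = card A + card (S - A)"
      using A by (metis card_Diff_subset card_mono finite le_add_diff_inverse)
    ultimately show ?thesis by simp
  qed
  then show ?thesis by (auto simp: ext_power_def)
qed

lemma ext_vec_in_ext_power: "ext_vec v \<in> ext_power 1"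
  by (simp add: ext_power_def ext_vec_def)

lemma ext_vec_nth [simp]: "ext_vec v $ {i} = v $ i"
  by (simp add: ext_vec_def)

lemma wedge_ext_vec_nth:
  fixes v w :: "'a::comm_ring_1 ^ 'n::{finite,linorder}"
  assumes "i < j"
  shows "(ext_vec v \<and>\<^sub>\<Lambda> ext_vec w) $ {i, j} = v $ i * w $ j - v $ j * w $ i"
proof -
  have P: "Pow {i, j} = {{}, {i}, {j}, {i, j}}" by auto
  have D: "{i, j} - {i} = {j}" "{i, j} - {j} = {i}" using assms by auto
  have "{(a, b). a \<in> {i} \<and> b \<in> {j} \<and> b < a} = {}"
    and "{(a, b). a \<in> {j} \<and> b \<in> {i} \<and> b < a} = {(j, i)}" using assms by auto
  then have s: "shuffle_sign {i} {j} = (1::'a)" "shuffle_sign {j} {i} = (-1::'a)"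
    by (simp_all only: shuffle_sign_def) simp_all
  have "ext_vec v $ {} = 0" "ext_vec w $ {} = 0" by (simp_all add: ext_vec_def)
  moreover have "{i} \<noteq> {j}" "{i} \<noteq> {i, j}" "{j} \<noteq> {i, j}" using assms by auto
  ultimately show ?thesis
    by (simp add: wedge_def P D s)
qed

lemma wedge_ext_vec_self: "ext_vec v \<and>\<^sub>\<Lambda> ext_vec v = 0"
proof -
  have "(ext_vec v \<and>\<^sub>\<Lambda> ext_vec v) $ S = 0" for S
  proof (cases "card S = 2")
    case True
    then obtain i j where "S = {i, j}" "i \<noteq> j" by (auto simp: card_2_iff)
    then have "\<exists>i j. S = {i, j} \<and> i < j"
      by (metis insert_commute linorder_neqE)
    then show ?thesis by (auto simp: wedge_ext_vec_nth)
  next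
    case False
    then show ?thesis
      using wedge_ext_power[OF ext_vec_in_ext_power ext_vec_in_ext_power, of v v]
      by (auto simp: ext_power_def numeral_2_eq_2)
  qed
  then show ?thesis by (simp add: vec_eq_iff)
qed

lemma ext_complex_wedge: "ext_complex (x \<and>\<^sub>\<Lambda> y) = ext_complex x \<and>\<^sub>\<Lambda> ext_complex y"
  by (simp add: ext_complex_def wedge_def vec_eq_iff shuffle_sign_def)

definition vol4 :: "(real, 4) exterior" where
  "vol4 = ext_vec (axis 1 1) \<and>\<^sub>\<Lambda> ext_vec (axis 2 1) \<and>\<^sub>\<Lambda> ext_vec (axis 3 1) \<and>\<^sub>\<Lambda> ext_vec (axis 4 1)"


section \<open>Lagrangian frames\<close>

definition symplectic_J :: "real ^ 4 ^ 4" where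
  "symplectic_J = vector
    [vector [0, 0, -1,  0],
     vector [0, 0,  0, -1],
     vector [1, 0,  0,  0],
     vector [0, 1,  0,  0]]"

definition lagrangian_frame :: "real ^ 2 ^ 4 \<Rightarrow> bool" where
  "lagrangian_frame Z \<longleftrightarrow>
     rank Z = 2 \<and> (symplectic_J *v column 1 Z) \<bullet> column 2 Z = 0"

definition upper_block :: "'a::zero ^ 2 ^ 4 \<Rightarrow> 'a ^ 2 ^ 2" where
  "upper_block Z = vector [Z $ 1, Z $ 2]"

definition lower_block :: "'a::zero ^ 2 ^ 4 \<Rightarrow> 'a ^ 2 ^ 2" where
  "lower_block Z = vector [Z $ 3, Z $ 4]"

end

theory Submission
  imports Defs
begin

text \<open>
  By rows, $X - iY$ is the pair of complex linear forms $\alpha_1 = e_1^* - i e_3^*$ and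
  $\alpha_2 = e_2^* - i e_4^*$ applied to the columns $z_1, z_2$, so its determinant is
  $(\alpha_1 \wedge \alpha_2)(z_1, z_2)$. This is a linear functional of $U = z_1 \wedge z_2$:
  \[ \det[X - iY] = U_{12} - i\,U_{14} - i\,U_{32} - U_{34}. \]
  The pairing of $\Lambda^2$ with itself into the line $\Lambda^4$ is perfect, so every such
  functional is $U \mapsto C \wedge U$ for a unique $C$. Reading $C$ off from
  $e_3 \wedge e_4 \wedge U = U_{12}\,\mathrm{vol}$ and its analogues gives
  \[ C = (e_3 + i e_1) \wedge (e_4 + i e_2), \]
  that is $C_1 = e_3 \wedge e_4 - e_1 \wedge e_2$ and $C_2 = e_1 \wedge e_4 - e_2 \wedge e_3$.

  Both sides of the claim lie in $\Lambda^4$, hence are determined by a single coordinate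
  (\<open>top_form_eqI\<close>), and that coordinate of a product of two 2-forms is given by the signed sum
  over the splittings of four indices into two pairs (\<open>wedge_two_forms_nth\<close>).
\<close>

lemma ext_complex_nth [simp]: "ext_complex x $ S = complex_of_real (x $ S)"
  by (simp add: ext_complex_def)

lemma ext_power_add: "x \<in> ext_power k \<Longrightarrow> y \<in> ext_power k \<Longrightarrow> x + y \<in> ext_power k"
  for x y :: "('a::comm_ring_1, 'n::finite) exterior"
  by (simp add: ext_power_def) (metis add.right_neutral)

lemma ext_power_diff: "x \<in> ext_power k \<Longrightarrow> y \<in> ext_power k \<Longrightarrow> x - y \<in> ext_power k"
  for x y :: "('a::comm_ring_1, 'n::finite) exterior"
  by (simp add: ext_power_def) metis

lemma ext_power_scale: "x \<in> ext_power k \<Longrightarrow> c *s x \<in> ext_power k"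
  for x :: "('a::comm_ring_1, 'n::finite) exterior"
  by (simp add: ext_power_def) (metis mult_zero_right)

lemma ext_power_complex: "x \<in> ext_power k \<Longrightarrow> ext_complex x \<in> ext_power k"
  by (simp add: ext_power_def)

lemma wedge_vectors_in_ext_power: "ext_vec v \<and>\<^sub>\<Lambda> ext_vec w \<in> ext_power 2"
  using wedge_ext_power[OF ext_vec_in_ext_power ext_vec_in_ext_power, of v w]
  by (simp only: one_add_one)

text \<open>The top exterior power is a line, because the full index set is the only one of its size.\<close>

lemma top_form_eqI:
  fixes x y :: "('a::zero, 'n::finite) exterior"
  assumes "x \<in> ext_power CARD('n)" "y \<in> ext_power CARD('n)" "x $ UNIV = y $ UNIV"
  shows "x = y"
proof -
  have "x $ S = y $ S" for S
  proof (cases "S = UNIV")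
    case False
    then have "card S \<noteq> CARD('n)" using card_subset_eq[of UNIV S] by auto
    then have "x $ S = 0" "y $ S = 0" using assms(1,2) by (auto simp: ext_power_def)
    then show ?thesis by simp
  qed (simp add: assms(3))
  then show ?thesis by (simp add: vec_eq_iff)
qed

lemma shuffle_sign_singletons: "shuffle_sign {i} {j} = (if j < i then - 1 else 1)"
proof -
  have "{(a, b). a \<in> {i} \<and> b \<in> {j} \<and> b < a} = (if j < i then {(i, j)} else {})" by auto
  then show ?thesis by (simp add: shuffle_sign_def)
qed

text \<open>
  Products of 2-forms see only the six ways of splitting four indices into two pairs. The two
  negative signs belong to the splitting into interleaved pairs, whose shuffle has odd length.
\<close>

lemma wedge_two_forms_nth:
  fixes x y :: "('a::comm_ring_1, 'n::{finite,linorder}) exterior"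
  assumes x: "x \<in> ext_power 2" and "i < j" "j < k" "k < l"
  shows "(x \<and>\<^sub>\<Lambda> y) $ {i, j, k, l} =
    x $ {i, j} * y $ {k, l} - x $ {i, k} * y $ {j, l} + x $ {i, l} * y $ {j, k} +
    x $ {j, k} * y $ {i, l} - x $ {j, l} * y $ {i, k} + x $ {k, l} * y $ {i, j}"
proof -
  let ?S = "{i, j, k, l}" and ?P = "{{i, j}, {i, k}, {i, l}, {j, k}, {j, l}, {k, l}}"
  let ?t = "\<lambda>A. shuffle_sign A (?S - A) * x $ A * y $ (?S - A)"
  have ne: "i \<noteq> j" "i \<noteq> k" "i \<noteq> l" "j \<noteq> k" "j \<noteq> l" "k \<noteq> l"
    using assms by auto
  have pairs: "A \<in> ?P" if sub: "A \<subseteq> ?S" and two: "card A = 2" for A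
  proof -
    obtain a b where "A = {a, b}" "a \<noteq> b" using two by (auto simp: card_2_iff)
    moreover have "a \<in> ?S" "b \<in> ?S" using sub \<open>A = {a, b}\<close> by simp_all
    ultimately show ?thesis
      by (simp add: doubleton_eq_iff) blast
  qed
  have "(\<Sum>A\<in>Pow ?S. ?t A) = (\<Sum>A\<in>?P. ?t A)"
  proof (rule sum.mono_neutral_right)
    show "\<forall>A\<in>Pow ?S - ?P. ?t A = 0"
    proof
      fix A assume A: "A \<in> Pow ?S - ?P"
      then have "card A \<noteq> 2" using pairs by blast
      then have "x $ A = 0" using x by (auto simp: ext_power_def)
      then show "?t A = 0" by simp
    qed
  qed auto
  also have "\<dots> = ?t {i, j} + ?t {i, k} + ?t {i, l} + ?t {j, k} + ?t {j, l} + ?t {k, l}"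
    using ne by (simp add: doubleton_eq_iff add.assoc)
  also have "\<dots> = shuffle_sign {i, j} {k, l} * x $ {i, j} * y $ {k, l}
      + shuffle_sign {i, k} {j, l} * x $ {i, k} * y $ {j, l}
      + shuffle_sign {i, l} {j, k} * x $ {i, l} * y $ {j, k}
      + shuffle_sign {j, k} {i, l} * x $ {j, k} * y $ {i, l}
      + shuffle_sign {j, l} {i, k} * x $ {j, l} * y $ {i, k}
      + shuffle_sign {k, l} {i, j} * x $ {k, l} * y $ {i, j}"
    using ne by (simp add: insert_Diff_if)
  also have "\<dots> = x $ {i, j} * y $ {k, l} - x $ {i, k} * y $ {j, l} + x $ {i, l} * y $ {j, k} +
    x $ {j, k} * y $ {i, l} - x $ {j, l} * y $ {i, k} + x $ {k, l} * y $ {i, j}"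
  proof -
    have pair_sign: "shuffle_sign {a, b} {c, d} =
        (shuffle_sign {a} {c} * shuffle_sign {a} {d} *
         (shuffle_sign {b} {c} * shuffle_sign {b} {d}) :: 'a)"
      if "a \<noteq> b" "c \<noteq> d" for a b c d :: 'n
      using that shuffle_sign_Un_left[of "{a}" "{b}" "{c, d}", where 'a = 'a]
        shuffle_sign_Un_right[of "{c}" "{d}" "{a}", where 'a = 'a]
        shuffle_sign_Un_right[of "{c}" "{d}" "{b}", where 'a = 'a]
      by (simp add: insert_commute)
    have lt: "i < j" "i < k" "i < l" "j < k" "j < l" "k < l"
      using assms by auto
    show ?thesis
      using ne lt lt[THEN less_not_sym] by (simp add: pair_sign shuffle_sign_singletons)
  qed
  finally show ?thesis by (simp add: wedge_def)
qed

text \<open>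
  In the index type the numeral \<open>4\<close> denotes \<open>0\<close>, so the increasing enumeration of the indices
  starts with it.
\<close>

lemma index4_less:
  "(4::4) < 1" "(4::4) < 2" "(4::4) < 3" "(1::4) < 2" "(1::4) < 3" "(2::4) < 3"
  by (simp_all add: less_bit0_def bit0.Rep_numeral bit0.Rep_1 bit0.Rep_0)

lemma index4_UNIV: "(UNIV :: 4 set) = {4, 1, 2, 3}"
  using UNIV_4 by auto

lemmas wedge_two_forms_top4 =
  wedge_two_forms_nth[OF _ index4_less(1,4,6), folded index4_UNIV]

lemma wedge_ext_vec_nth4:
  fixes v w :: "'a::comm_ring_1 ^ 4"
  shows "(ext_vec v \<and>\<^sub>\<Lambda> ext_vec w) $ {4, 1} = v $ 4 * w $ 1 - v $ 1 * w $ 4"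
    "(ext_vec v \<and>\<^sub>\<Lambda> ext_vec w) $ {4, 2} = v $ 4 * w $ 2 - v $ 2 * w $ 4"
    "(ext_vec v \<and>\<^sub>\<Lambda> ext_vec w) $ {4, 3} = v $ 4 * w $ 3 - v $ 3 * w $ 4"
    "(ext_vec v \<and>\<^sub>\<Lambda> ext_vec w) $ {1, 2} = v $ 1 * w $ 2 - v $ 2 * w $ 1"
    "(ext_vec v \<and>\<^sub>\<Lambda> ext_vec w) $ {1, 3} = v $ 1 * w $ 3 - v $ 3 * w $ 1"
    "(ext_vec v \<and>\<^sub>\<Lambda> ext_vec w) $ {2, 3} = v $ 2 * w $ 3 - v $ 3 * w $ 2"
  by (rule wedge_ext_vec_nth; simp add: index4_less)+

lemma vol4_alt: "vol4 = (ext_vec (axis 1 1) \<and>\<^sub>\<Lambda> ext_vec (axis 2 1)) \<and>\<^sub>\<Lambda>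
    (ext_vec (axis 3 1) \<and>\<^sub>\<Lambda> ext_vec (axis 4 1))"
  by (simp add: vol4_def wedge_assoc)

text \<open>Moving the least index \<open>4\<close> from the last to the first place is an odd permutation.\<close>

lemma vol4_nth_UNIV: "vol4 $ UNIV = - 1"
  by (simp add: vol4_alt wedge_two_forms_top4 wedge_vectors_in_ext_power wedge_ext_vec_nth4
      axis_def)

lemma vol4_in_ext_power: "vol4 \<in> ext_power 4"
  using wedge_ext_power[OF wedge_vectors_in_ext_power wedge_vectors_in_ext_power]
  by (simp add: vol4_alt)

theorem proposition3:
  shows "\<exists>C1 \<in> ext_power 2. \<exists>C2 \<in> ext_power 2. \<forall>Z :: real ^ 2 ^ 4. lagrangian_frame Z \<longrightarrow>
    (let X = map_matrix complex_of_real (upper_block Z);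
         Y = map_matrix complex_of_real (lower_block Z);
         C = ext_complex C1 + \<i> *s ext_complex C2;
         U = ext_vec (column 1 Z) \<and>\<^sub>\<Lambda> ext_vec (column 2 Z)
     in det (X - (\<chi> i j. \<i> * Y $ i $ j)) *s ext_complex vol4 = C \<and>\<^sub>\<Lambda> ext_complex U)"
proof -
  define e :: "4 \<Rightarrow> (real, 4) exterior" where "e i = ext_vec (axis i 1)" for i
  define C1 where "C1 = e 3 \<and>\<^sub>\<Lambda> e 4 - e 1 \<and>\<^sub>\<Lambda> e 2"
  define C2 where "C2 = e 1 \<and>\<^sub>\<Lambda> e 4 - e 2 \<and>\<^sub>\<Lambda> e 3"
  define C where "C = ext_complex C1 + \<i> *s ext_complex C2"
  have C12: "C1 \<in> ext_power 2" "C2 \<in> ext_power 2"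
    unfolding C1_def C2_def e_def by (intro ext_power_diff wedge_vectors_in_ext_power)+
  then have C: "C \<in> ext_power 2"
    unfolding C_def by (intro ext_power_add ext_power_scale ext_power_complex)
  have "det (map_matrix complex_of_real (upper_block Z) -
        (\<chi> i j. \<i> * map_matrix complex_of_real (lower_block Z) $ i $ j)) *s ext_complex vol4
      = C \<and>\<^sub>\<Lambda> ext_complex (ext_vec (column 1 Z) \<and>\<^sub>\<Lambda> ext_vec (column 2 Z))"
    (is "?d *s _ = _ \<and>\<^sub>\<Lambda> ext_complex ?U") for Z :: "real ^ 2 ^ 4"
  proof (rule top_form_eqI)
    show "?d *s ext_complex vol4 \<in> ext_power CARD(4)"
      using ext_power_scale[OF ext_power_complex[OF vol4_in_ext_power]] by simp
    show "C \<and>\<^sub>\<Lambda> ext_complex ?U \<in> ext_power CARD(4)"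
      using wedge_ext_power[OF C ext_power_complex[OF wedge_vectors_in_ext_power]] by simp
    have "?d = (Z $ 1 $ 1 - \<i> * Z $ 3 $ 1) * (Z $ 2 $ 2 - \<i> * Z $ 4 $ 2)
        - (Z $ 1 $ 2 - \<i> * Z $ 3 $ 2) * (Z $ 2 $ 1 - \<i> * Z $ 4 $ 1)"
      by (simp add: det_2 upper_block_def lower_block_def map_matrix_def)
    \<comment> \<open>The minus sign below is the coordinate of the volume form.\<close>
    moreover have "(C \<and>\<^sub>\<Lambda> ext_complex ?U) $ UNIV =
        - ((Z $ 1 $ 1 - \<i> * Z $ 3 $ 1) * (Z $ 2 $ 2 - \<i> * Z $ 4 $ 2)
        - (Z $ 1 $ 2 - \<i> * Z $ 3 $ 2) * (Z $ 2 $ 1 - \<i> * Z $ 4 $ 1))"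
      by (simp add: wedge_two_forms_top4[OF C])
         (simp add: C_def C1_def C2_def e_def wedge_ext_vec_nth4 axis_def column_def algebra_simps)
    ultimately show "(?d *s ext_complex vol4) $ UNIV = (C \<and>\<^sub>\<Lambda> ext_complex ?U) $ UNIV"
      by (simp add: vol4_nth_UNIV)
  qed
  then show ?thesis
    using C12 unfolding C_def Let_def by blast
qed

end
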